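(* Let $\mathcal{E}$ be a set of equations and $\mathcal{R}$ a set of rewrite rules over the terms described in the context, with $\sim$, $\to_{\mathcal{R}}$, $\rhd\!\!\!\!\rhd$ as defined there. Assume: (1) $\mathcal{E}$ is linear; (2) $\mathcal{R}$ is left-linear: in every rule $l\to r\in\mathcal{R}$, no variable occurs more than once in $l$; (3) $\to_{\mathcal{R}}$ is $\sim$-confluent on $\sim$-classes: for all $t,t',u,v$ with $t\to_{\mathcal{R}}^*u$, $t\sim t'$ and $t'\to_{\mathcal{R}}^*v$, there exist $u',v'$ with $u\to_{\mathcal{R}}^*u'$, $v\to_{\mathcal{R}}^*v'$ and $u'\sim v'$. Then $\rhd\!\!\!\!\rhd$ is $\sim$-confluent on $\sim$-classes: for all $t,t',u,v$ with $t\rhd\!\!\!\!\rhd^*u$, $t\sim t'$ and $t'\rhd\!\!\!\!\rhd^*v$, there exist $u',v'$ with $u\rhd\!\!\!\!\rhd^*u'$, $v\rhd\!\!\!\!\rhd^*v'$ and $u'\sim v'$.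
   Context: Terms (considered modulo renaming of bound variables): $t,u ::= s \mid x \mid f \mid [x:t]u \mid tu \mid (x:t)u$, where $s\in\{\star,\Box\}$ is a sort, $x$ ranges over an infinite set of variables, $f$ ranges over a set $\mathcal{F}$ of symbols, $[x:t]u$ is an abstraction (binding $x$ in $u$), $tu$ an application and $(x:t)u$ a dependent product (binding $x$ in $u$). Every symbol $f$ has an arity $\alpha_f\in\mathbb{N}$. A term is algebraic if it is built only from variables and applications $f t_1\ldots t_n$ with $n=\alpha_f$. $\mathrm{FV}(t)$ is the set of free variables of $t$; $t|_p$ is the subterm at position $p$ and $t[u]_p$ the replacement of $t|_p$ by $u$. A rewrite rule is a pair $l\to r$ of terms with $l$ algebraic, $l$ not a variable, and $\mathrm{FV}(r)\subseteq\mathrm{FV}(l)$. For a set of rules $\mathcal{R}$, $t\to_{\mathcal{R}} t'$ iff there are a position $p$, a rule $l\to r\in\mathcal{R}$ and a substitution $\sigma$ with $t|_p=l\sigma$ and $t'=t[r\sigma]_p$. $t\to_\beta t'$ iff there is a position $p$ with $t|_p=([x:U]v)\,u$ and $t'=t[v\{x\mapsto u\}]_p$. A set of equations $\mathcal{E}$ is a set of rewrite rules that is symmetric ($l\to r\in\mathcal{E}$ iff $r\to l\in\mathcal{E}$), such that for each $l\to r\in\mathcal{E}$ both $l$ and $r$ are algebraic, headed by a symbol, and $\mathrm{FV}(l)=\mathrm{FV}(r)$. $\mathcal{E}$ is linear if in every rule of $\mathcal{E}$ no variable occurs more than once in the left-hand side and no variable occurs more than once in the right-hand side. $\sim$ is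 the reflexive and transitive closure of $\to_{\mathcal{E}}$. $t\rhd\!\!\!\!\rhd u$ iff $t\to_\beta u$, or there exists $t'$ with $t\sim t'$ and $t'\to_{\mathcal{R}} u$. $S^*$ is the reflexive and transitive closure of a relation $S$. *)

theory Defs
  imports Main
begin

text \<open>
  Terms modulo renaming of bound variables are represented by de Bruijn indices, so that
  syntactic equality is equality modulo renaming; the index set \<open>nat\<close> plays the role of
  the infinite set of variables. \<open>Lam T u\<close> is the abstraction [x:T]u and \<open>Prod T u\<close> the
  product (x:T)u; both bind index 0 in \<open>u\<close> only.
\<close>

datatype srt = Star | Box

datatype 'f trm =
    Srt srt
  | Var nat
  | Sym 'f
  | Lam "'f trm" "'f trm"
  | App "'f trm" "'f trm"
  | Prod "'f trm" "'f trm"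

primrec FV :: "'f trm \<Rightarrow> nat set" where
  "FV (Srt s) = {}"
| "FV (Var x) = {x}"
| "FV (Sym f) = {}"
| "FV (Lam T u) = FV T \<union> {x. Suc x \<in> FV u}"
| "FV (App t u) = FV t \<union> FV u"
| "FV (Prod T u) = FV T \<union> {x. Suc x \<in> FV u}"

text \<open>Number of free occurrences of a variable.\<close>

primrec occs :: "nat \<Rightarrow> 'f trm \<Rightarrow> nat" where
  "occs x (Srt s) = 0"
| "occs x (Var y) = (if x = y then 1 else 0)"
| "occs x (Sym f) = 0"
| "occs x (Lam T u) = occs x T + occs (Suc x) u"
| "occs x (App t u) = occs x t + occs x u"
| "occs x (Prod T u) = occs x T + occs (Suc x) u"

definition linear_trm :: "'f trm \<Rightarrow> bool" where
  "linear_trm t \<longleftrightarrow> (\<forall>x. occs x t \<le> 1)"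

text \<open>Capture-avoiding simultaneous substitution, via renaming of free variables.\<close>

primrec ren :: "(nat \<Rightarrow> nat) \<Rightarrow> 'f trm \<Rightarrow> 'f trm" where
  "ren \<rho> (Srt s) = Srt s"
| "ren \<rho> (Var x) = Var (\<rho> x)"
| "ren \<rho> (Sym f) = Sym f"
| "ren \<rho> (Lam T u) = Lam (ren \<rho> T) (ren (case_nat 0 (\<lambda>x. Suc (\<rho> x))) u)"
| "ren \<rho> (App t u) = App (ren \<rho> t) (ren \<rho> u)"
| "ren \<rho> (Prod T u) = Prod (ren \<rho> T) (ren (case_nat 0 (\<lambda>x. Suc (\<rho> x))) u)"

definition up :: "(nat \<Rightarrow> 'f trm) \<Rightarrow> nat \<Rightarrow> 'f trm" where
  "up \<sigma> = case_nat (Var 0) (\<lambda>x. ren Suc (\<sigma> x))"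

primrec subst :: "(nat \<Rightarrow> 'f trm) \<Rightarrow> 'f trm \<Rightarrow> 'f trm" where
  "subst \<sigma> (Srt s) = Srt s"
| "subst \<sigma> (Var x) = \<sigma> x"
| "subst \<sigma> (Sym f) = Sym f"
| "subst \<sigma> (Lam T u) = Lam (subst \<sigma> T) (subst (up \<sigma>) u)"
| "subst \<sigma> (App t u) = App (subst \<sigma> t) (subst \<sigma> u)"
| "subst \<sigma> (Prod T u) = Prod (subst \<sigma> T) (subst (up \<sigma>) u)"

text \<open>
  \<open>inst v u\<close> substitutes \<open>u\<close> for x in the body \<open>v\<close> of a binder of x: the index 0 is
  replaced by \<open>u\<close> and the remaining indices are lowered, since the binder disappears.
\<close>

definition inst :: "'f trm \<Rightarrow> 'f trm \<Rightarrow> 'f trm" where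
  "inst v u = subst (case_nat u Var) v"

text \<open>
  Positions are paths to a left or right child. Below a binder, indices are read in the
  context of the position, so a replacement may capture, as it does for named terms.
\<close>

datatype dir = Lft | Rgt

type_synonym pos = "dir list"

primrec poss :: "'f trm \<Rightarrow> pos set" where
  "poss (Srt s) = {[]}"
| "poss (Var x) = {[]}"
| "poss (Sym f) = {[]}"
| "poss (Lam T u) = {[]} \<union> Cons Lft ` poss T \<union> Cons Rgt ` poss u"
| "poss (App t u) = {[]} \<union> Cons Lft ` poss t \<union> Cons Rgt ` poss u"
| "poss (Prod T u) = {[]} \<union> Cons Lft ` poss T \<union> Cons Rgt ` poss u"

text \<open>The next two functions are only meaningful, and only used, at positions in \<open>poss t\<close>.\<close>

fun subt_at :: "'f trm \<Rightarrow> pos \<Rightarrow> 'f trm" where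
  "subt_at t [] = t"
| "subt_at (Lam T u) (Lft # p) = subt_at T p"
| "subt_at (Lam T u) (Rgt # p) = subt_at u p"
| "subt_at (App t u) (Lft # p) = subt_at t p"
| "subt_at (App t u) (Rgt # p) = subt_at u p"
| "subt_at (Prod T u) (Lft # p) = subt_at T p"
| "subt_at (Prod T u) (Rgt # p) = subt_at u p"
| "subt_at t (d # p) = undefined"

fun replace_at :: "'f trm \<Rightarrow> pos \<Rightarrow> 'f trm \<Rightarrow> 'f trm" where
  "replace_at t [] w = w"
| "replace_at (Lam T u) (Lft # p) w = Lam (replace_at T p w) u"
| "replace_at (Lam T u) (Rgt # p) w = Lam T (replace_at u p w)"
| "replace_at (App t u) (Lft # p) w = App (replace_at t p w) u"
| "replace_at (App t u) (Rgt # p) w = App t (replace_at u p w)"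
| "replace_at (Prod T u) (Lft # p) w = Prod (replace_at T p w) u"
| "replace_at (Prod T u) (Rgt # p) w = Prod T (replace_at u p w)"
| "replace_at t (d # p) w = undefined"

definition apps :: "'f \<Rightarrow> 'f trm list \<Rightarrow> 'f trm" where
  "apps f ts = foldl App (Sym f) ts"

inductive algebraic :: "('f \<Rightarrow> nat) \<Rightarrow> 'f trm \<Rightarrow> bool" for ar where
  "algebraic ar (Var x)"
| "length ts = ar f \<Longrightarrow> (\<And>t. t \<in> set ts \<Longrightarrow> algebraic ar t) \<Longrightarrow> algebraic ar (apps f ts)"

definition symbol_headed :: "'f trm \<Rightarrow> bool" where
  "symbol_headed t \<longleftrightarrow> (\<exists>f ts. t = apps f ts)"

definition rewrite_rules :: "('f \<Rightarrow> nat) \<Rightarrow> 'f trm rel \<Rightarrow> bool" where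
  "rewrite_rules ar S \<longleftrightarrow>
    (\<forall>(l, r) \<in> S. algebraic ar l \<and> (\<forall>x. l \<noteq> Var x) \<and> FV r \<subseteq> FV l)"

definition equations :: "('f \<Rightarrow> nat) \<Rightarrow> 'f trm rel \<Rightarrow> bool" where
  "equations ar E \<longleftrightarrow>
    rewrite_rules ar E \<and> sym E \<and>
    (\<forall>(l, r) \<in> E. algebraic ar l \<and> algebraic ar r \<and>
       symbol_headed l \<and> symbol_headed r \<and> FV l = FV r)"

definition left_linear :: "'f trm rel \<Rightarrow> bool" where
  "left_linear S \<longleftrightarrow> (\<forall>(l, r) \<in> S. linear_trm l)"

definition linear_rules :: "'f trm rel \<Rightarrow> bool" where
  "linear_rules S \<longleftrightarrow> (\<forall>(l, r) \<in> S. linear_trm l \<and> linear_trm r)"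

definition rstep :: "'f trm rel \<Rightarrow> 'f trm \<Rightarrow> 'f trm \<Rightarrow> bool" where
  "rstep S t t' \<longleftrightarrow>
    (\<exists>p \<in> poss t. \<exists>(l, r) \<in> S. \<exists>\<sigma>.
       subt_at t p = subst \<sigma> l \<and> t' = replace_at t p (subst \<sigma> r))"

definition beta :: "'f trm \<Rightarrow> 'f trm \<Rightarrow> bool" where
  "beta t t' \<longleftrightarrow>
    (\<exists>p \<in> poss t. \<exists>U v u.
       subt_at t p = App (Lam U v) u \<and> t' = replace_at t p (inst v u))"

definition equiv_mod :: "'f trm rel \<Rightarrow> 'f trm \<Rightarrow> 'f trm \<Rightarrow> bool" where
  "equiv_mod E = (rstep E)\<^sup>*\<^sup>*"

definition red_mod :: "'f trm rel \<Rightarrow> 'f trm rel \<Rightarrow> 'f trm \<Rightarrow> 'f trm \<Rightarrow> bool" where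
  "red_mod E R t u \<longleftrightarrow> beta t u \<or> (\<exists>t'. equiv_mod E t t' \<and> rstep R t' u)"

definition confluent_on_classes ::
    "('a \<Rightarrow> 'a \<Rightarrow> bool) \<Rightarrow> ('a \<Rightarrow> 'a \<Rightarrow> bool) \<Rightarrow> bool" where
  "confluent_on_classes eq S \<longleftrightarrow>
    (\<forall>t t' u v. S\<^sup>*\<^sup>* t u \<and> eq t t' \<and> S\<^sup>*\<^sup>* t' v \<longrightarrow>
       (\<exists>u' v'. S\<^sup>*\<^sup>* u u' \<and> S\<^sup>*\<^sup>* v v' \<and> eq u' v'))"

end

theory Submission
  imports Defs "HOL-Library.Confluence"
begin

text \<open>
  Since left-hand sides of rules are algebraic and linear, a parallel \<open>\<beta>\<close>-step from an instance of
  a left-hand side can only act inside the substitution. Hence a parallel \<open>\<beta>\<close>-step commutes with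
  any sequence of steps of \<open>E\<close>, and likewise of \<open>R\<close>. Therefore the union \<open>W\<close> of parallel
  \<open>\<beta>\<close>-reduction with \<open>\<sim> \<rightarrow>\<^sub>R\<^sup>* \<sim>\<close> has the diamond property: parallel \<open>\<beta>\<close>-reduction by
  the argument of Tait and Martin-Loef, the other component by hypothesis. Finally, \<open>\<sim>\<close> can
  be moved to the end of a \<open>W\<close>-reduction sequence, which turns it into a reduction of the
  combined relation followed by \<open>\<sim>\<close>.
\<close>

subsection \<open>Substitution\<close>

lemma up_simps [simp]: "up \<sigma> 0 = Var 0" "up \<sigma> (Suc n) = ren Suc (\<sigma> n)"
  by (simp_all add: up_def)

lemma up_Var [simp]: "up Var = Var"
  by (rule ext) (simp add: up_def split: nat.split)

lemma subst_Var [simp]: "subst Var t = t"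
  by (induction t) simp_all

lemma subst_cong_FV: "(\<And>x. x \<in> FV t \<Longrightarrow> \<sigma> x = \<tau> x) \<Longrightarrow> subst \<sigma> t = subst \<tau> t"
proof (induction t arbitrary: \<sigma> \<tau>)
  case (Lam T u)
  have "subst (up \<sigma>) u = subst (up \<tau>) u"
    by (rule Lam.IH) (use Lam.prems in \<open>auto simp: up_def split: nat.split\<close>)
  moreover have "subst \<sigma> T = subst \<tau> T"
    using Lam.prems by (auto intro!: Lam.IH)
  ultimately show ?case by simp
next
  case (App t u)
  have "subst \<sigma> t = subst \<tau> t" "subst \<sigma> u = subst \<tau> u"
    using App.prems by (auto intro!: App.IH)
  then show ?case by simp
next
  case (Prod T u)
  have "subst (up \<sigma>) u = subst (up \<tau>) u"
    by (rule Prod.IH) (use Prod.prems in \<open>auto simp: up_def split: nat.split\<close>)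
  moreover have "subst \<sigma> T = subst \<tau> T"
    using Prod.prems by (auto intro!: Prod.IH)
  ultimately show ?case by simp
qed simp_all

text \<open>Composition is built in stages, because \<open>up\<close> renames by \<open>Suc\<close>
  below a binder. This law gives \<open>ren_ren\<close>, as a renaming is a substitution by
  variables; \<open>ren_ren\<close> gives \<open>ren_subst\<close>, and the two mixed laws together
  give \<open>subst_subst\<close>.\<close>

lemma subst_ren: "subst \<sigma> (ren \<rho> t) = subst (\<lambda>x. \<sigma> (\<rho> x)) t"
proof (induction t arbitrary: \<sigma> \<rho>)
  case (Lam T u)
  have "(\<lambda>x. up \<sigma> (case_nat 0 (\<lambda>x. Suc (\<rho> x)) x)) = up (\<lambda>x. \<sigma> (\<rho> x))"
    by (rule ext) (simp add: up_def split: nat.split)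
  with Lam show ?case by simp
next
  case (Prod T u)
  have "(\<lambda>x. up \<sigma> (case_nat 0 (\<lambda>x. Suc (\<rho> x)) x)) = up (\<lambda>x. \<sigma> (\<rho> x))"
    by (rule ext) (simp add: up_def split: nat.split)
  with Prod show ?case by simp
qed simp_all

lemma up_ren: "up (\<lambda>x. Var (\<rho> x)) = (\<lambda>x. Var (case_nat 0 (\<lambda>x. Suc (\<rho> x)) x))"
  by (rule ext) (simp add: up_def split: nat.split)

lemma ren_conv_subst: "ren \<rho> t = subst (\<lambda>x. Var (\<rho> x)) t"
  by (induction t arbitrary: \<rho>) (simp_all add: up_ren)

lemma ren_ren: "ren \<rho> (ren \<rho>' t) = ren (\<lambda>x. \<rho> (\<rho>' x)) t"
  by (simp only: ren_conv_subst[of \<rho>] subst_ren) (simp only: ren_conv_subst)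

lemma ren_up: "(\<lambda>x. ren (case_nat 0 (\<lambda>x. Suc (\<rho> x))) (up \<sigma> x)) = up (\<lambda>x. ren \<rho> (\<sigma> x))"
  by (rule ext) (simp add: up_def ren_ren split: nat.split)

lemma ren_subst: "ren \<rho> (subst \<sigma> t) = subst (\<lambda>x. ren \<rho> (\<sigma> x)) t"
  by (induction t arbitrary: \<rho> \<sigma>) (simp_all add: ren_up)

lemma subst_up: "(\<lambda>x. subst (up \<tau>) (up \<sigma> x)) = up (\<lambda>x. subst \<tau> (\<sigma> x))"
  by (rule ext) (simp add: up_def subst_ren ren_subst split: nat.split)

lemma subst_subst: "subst \<tau> (subst \<sigma> t) = subst (\<lambda>x. subst \<tau> (\<sigma> x)) t"
  by (induction t arbitrary: \<tau> \<sigma>) (simp_all add: subst_up)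

text \<open>The substitution lemma of the lambda calculus: it makes contraction of a redex stable
  under substitution.\<close>

lemma subst_inst: "subst \<tau> (inst v u) = inst (subst (up \<tau>) v) (subst \<tau> u)"
proof -
  \<comment> \<open>Both sides compose to one substitution of \<open>v\<close>. At index 0 both
    yield \<open>subst \<tau> u\<close>; at a successor, the shift introduced by \<open>up\<close>
    is undone when the binder disappears.\<close>
  have "(\<lambda>x. subst \<tau> (case_nat u Var x)) =
      (\<lambda>x. subst (case_nat (subst \<tau> u) Var) (up \<tau> x))"
    by (rule ext) (simp add: up_def subst_ren split: nat.split)
  then show ?thesis by (simp add: inst_def subst_subst)
qed

lemma ren_inst: "ren \<rho> (inst v u) = inst (ren (case_nat 0 (\<lambda>x. Suc (\<rho> x))) v) (ren \<rho> u)"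
  by (simp add: ren_conv_subst subst_inst up_ren)

subsection \<open>Contextual closure\<close>

text \<open>Positions are replaced by rules in order to have rule induction and inversion. Nothing
  is shifted below a binder, in agreement with \<open>replace_at\<close>.\<close>

inductive cclosure :: "('f trm \<Rightarrow> 'f trm \<Rightarrow> bool) \<Rightarrow> 'f trm \<Rightarrow> 'f trm \<Rightarrow> bool" for P where
  root: "P t t' \<Longrightarrow> cclosure P t t'"
| LamL: "cclosure P T T' \<Longrightarrow> cclosure P (Lam T u) (Lam T' u)"
| LamR: "cclosure P u u' \<Longrightarrow> cclosure P (Lam T u) (Lam T u')"
| AppL: "cclosure P t t' \<Longrightarrow> cclosure P (App t u) (App t' u)"
| AppR: "cclosure P u u' \<Longrightarrow> cclosure P (App t u) (App t u')"
| ProdL: "cclosure P T T' \<Longrightarrow> cclosure P (Prod T u) (Prod T' u)"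
| ProdR: "cclosure P u u' \<Longrightarrow> cclosure P (Prod T u) (Prod T u')"

lemma cclosure_replace_at:
  "p \<in> poss t \<Longrightarrow> P (subt_at t p) w \<Longrightarrow> cclosure P t (replace_at t p w)"
  by (induction t p w rule: replace_at.induct) (auto intro: cclosure.intros)

lemma cclosure_imp_poss:
  "cclosure P t t' \<Longrightarrow> \<exists>p \<in> poss t. \<exists>w. P (subt_at t p) w \<and> t' = replace_at t p w"
proof (induction rule: cclosure.induct)
  case (root t t')
  then show ?case by (intro bexI[of _ "[]"]) (cases t; auto)+
next
  case (LamL T T' u)
  then obtain p w where "p \<in> poss T" "P (subt_at T p) w" "T' = replace_at T p w" by blast
  then show ?case by (intro bexI[of _ "Lft # p"] exI[of _ w]) auto
next
  case (LamR u u' T)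
  then obtain p w where "p \<in> poss u" "P (subt_at u p) w" "u' = replace_at u p w" by blast
  then show ?case by (intro bexI[of _ "Rgt # p"] exI[of _ w]) auto
next
  case (AppL T T' u)
  then obtain p w where "p \<in> poss T" "P (subt_at T p) w" "T' = replace_at T p w" by blast
  then show ?case by (intro bexI[of _ "Lft # p"] exI[of _ w]) auto
next
  case (AppR u u' T)
  then obtain p w where "p \<in> poss u" "P (subt_at u p) w" "u' = replace_at u p w" by blast
  then show ?case by (intro bexI[of _ "Rgt # p"] exI[of _ w]) auto
next
  case (ProdL T T' u)
  then obtain p w where "p \<in> poss T" "P (subt_at T p) w" "T' = replace_at T p w" by blast
  then show ?case by (intro bexI[of _ "Lft # p"] exI[of _ w]) auto
next
  case (ProdR u u' T)
  then obtain p w where "p \<in> poss u" "P (subt_at u p) w" "u' = replace_at u p w" by blast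
  then show ?case by (intro bexI[of _ "Rgt # p"] exI[of _ w]) auto
qed

lemma cclosure_conv_poss:
  "cclosure P t t' \<longleftrightarrow> (\<exists>p \<in> poss t. \<exists>w. P (subt_at t p) w \<and> t' = replace_at t p w)"
  using cclosure_imp_poss cclosure_replace_at by metis

section \<open>Rewriting and beta as contextual closures of root steps\<close>

definition rule_inst :: "'f trm rel \<Rightarrow> 'f trm \<Rightarrow> 'f trm \<Rightarrow> bool" where
  "rule_inst S t t' \<longleftrightarrow> (\<exists>(l, r) \<in> S. \<exists>\<sigma>. t = subst \<sigma> l \<and> t' = subst \<sigma> r)"

definition beta_redex :: "'f trm \<Rightarrow> 'f trm \<Rightarrow> bool" where
  "beta_redex t t' \<longleftrightarrow> (\<exists>U v u. t = App (Lam U v) u \<and> t' = inst v u)"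

lemma rstep_conv_cclosure: "rstep S = cclosure (rule_inst S)"
  unfolding fun_eq_iff rstep_def cclosure_conv_poss rule_inst_def by blast

lemma beta_conv_cclosure: "beta = cclosure beta_redex"
  unfolding fun_eq_iff beta_def cclosure_conv_poss beta_redex_def by blast

lemma rtranclp_cclosure_Lam:
  assumes "(cclosure P)\<^sup>*\<^sup>* T T'" "(cclosure P)\<^sup>*\<^sup>* u u'"
  shows "(cclosure P)\<^sup>*\<^sup>* (Lam T u) (Lam T' u')"
proof -
  have "(cclosure P)\<^sup>*\<^sup>* (Lam T u) (Lam T' u)"
    using assms(1) by induction (auto intro: cclosure.intros rtranclp.rtrancl_into_rtrancl)
  moreover have "(cclosure P)\<^sup>*\<^sup>* (Lam T' u) (Lam T' u')"
    using assms(2) by induction (auto intro: cclosure.intros rtranclp.rtrancl_into_rtrancl)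
  ultimately show ?thesis by (rule rtranclp_trans)
qed

lemma rtranclp_cclosure_App:
  assumes "(cclosure P)\<^sup>*\<^sup>* T T'" "(cclosure P)\<^sup>*\<^sup>* u u'"
  shows "(cclosure P)\<^sup>*\<^sup>* (App T u) (App T' u')"
proof -
  have "(cclosure P)\<^sup>*\<^sup>* (App T u) (App T' u)"
    using assms(1) by induction (auto intro: cclosure.intros rtranclp.rtrancl_into_rtrancl)
  moreover have "(cclosure P)\<^sup>*\<^sup>* (App T' u) (App T' u')"
    using assms(2) by induction (auto intro: cclosure.intros rtranclp.rtrancl_into_rtrancl)
  ultimately show ?thesis by (rule rtranclp_trans)
qed

lemma rtranclp_cclosure_Prod:
  assumes "(cclosure P)\<^sup>*\<^sup>* T T'" "(cclosure P)\<^sup>*\<^sup>* u u'"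
  shows "(cclosure P)\<^sup>*\<^sup>* (Prod T u) (Prod T' u')"
proof -
  have "(cclosure P)\<^sup>*\<^sup>* (Prod T u) (Prod T' u)"
    using assms(1) by induction (auto intro: cclosure.intros rtranclp.rtrancl_into_rtrancl)
  moreover have "(cclosure P)\<^sup>*\<^sup>* (Prod T' u) (Prod T' u')"
    using assms(2) by induction (auto intro: cclosure.intros rtranclp.rtrancl_into_rtrancl)
  ultimately show ?thesis by (rule rtranclp_trans)
qed

lemmas rtranclp_cclosure_congs =
  rtranclp_cclosure_Lam rtranclp_cclosure_App rtranclp_cclosure_Prod

section \<open>Closure of rewriting under substitution\<close>

lemma rstep_subst:
  assumes "rstep S t t'"
  shows "rstep S (subst \<tau> t) (subst \<tau> t')"
  using assms unfolding rstep_conv_cclosure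
proof (induction arbitrary: \<tau> rule: cclosure.induct)
  case (root t t')
  then have "rule_inst S (subst \<tau> t) (subst \<tau> t')"
    unfolding rule_inst_def by (force simp: subst_subst)
  then show ?case by (rule cclosure.root)
qed (auto intro: cclosure.intros)

lemma rstep_rtranclp_subst:
  "(rstep S)\<^sup>*\<^sup>* t t' \<Longrightarrow> (rstep S)\<^sup>*\<^sup>* (subst \<tau> t) (subst \<tau> t')"
  by (induction rule: rtranclp_induct) (auto intro: rstep_subst rtranclp.rtrancl_into_rtrancl)

lemma rstep_rtranclp_ren: "(rstep S)\<^sup>*\<^sup>* t t' \<Longrightarrow> (rstep S)\<^sup>*\<^sup>* (ren \<rho> t) (ren \<rho> t')"
  by (simp add: ren_conv_subst rstep_rtranclp_subst)

text \<open>A variable can occur any number of times in \<open>t\<close>, and each occurrence has to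
  be rewritten separately; hence a sequence of steps.\<close>

lemma rstep_rtranclp_subst_arg:
  "(\<And>x. (rstep S)\<^sup>*\<^sup>* (\<sigma> x) (\<tau> x)) \<Longrightarrow> (rstep S)\<^sup>*\<^sup>* (subst \<sigma> t) (subst \<tau> t)"
proof (induction t arbitrary: \<sigma> \<tau>)
  case (Lam T u)
  have "(rstep S)\<^sup>*\<^sup>* (up \<sigma> x) (up \<tau> x)" for x
    using Lam.prems by (cases x) (auto intro: rstep_rtranclp_ren)
  with Lam show ?case unfolding rstep_conv_cclosure by (simp add: rtranclp_cclosure_congs)
next
  case (Prod T u)
  have "(rstep S)\<^sup>*\<^sup>* (up \<sigma> x) (up \<tau> x)" for x
    using Prod.prems by (cases x) (auto intro: rstep_rtranclp_ren)
  with Prod show ?case unfolding rstep_conv_cclosure by (simp add: rtranclp_cclosure_congs)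
qed (simp_all add: rstep_conv_cclosure rtranclp_cclosure_congs)

lemma rstep_rtranclp_inst:
  assumes "(rstep S)\<^sup>*\<^sup>* v v'" "(rstep S)\<^sup>*\<^sup>* u u'"
  shows "(rstep S)\<^sup>*\<^sup>* (inst v u) (inst v' u')"
proof -
  have "(rstep S)\<^sup>*\<^sup>* (inst v u) (inst v' u)"
    unfolding inst_def using assms(1) by (rule rstep_rtranclp_subst)
  moreover have "(rstep S)\<^sup>*\<^sup>* (inst v' u) (inst v' u')"
    unfolding inst_def
    by (rule rstep_rtranclp_subst_arg) (use assms(2) in \<open>simp split: nat.split\<close>)
  ultimately show ?thesis by (rule rtranclp_trans)
qed

subsection \<open>Parallel \<open>\<beta>\<close>-reduction\<close>

text \<open>Residuals of a redex can be contracted together in one step, which a single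
  \<open>beta\<close> step cannot do. The rule \<open>beta\<close> leaves \<open>U\<close> alone,
  since contraction discards it.\<close>

inductive par :: "'f trm \<Rightarrow> 'f trm \<Rightarrow> bool" where
  Srt: "par (Srt s) (Srt s)"
| Var: "par (Var x) (Var x)"
| Sym: "par (Sym f) (Sym f)"
| Lam: "par T T' \<Longrightarrow> par u u' \<Longrightarrow> par (Lam T u) (Lam T' u')"
| App: "par t t' \<Longrightarrow> par u u' \<Longrightarrow> par (App t u) (App t' u')"
| Prod: "par T T' \<Longrightarrow> par u u' \<Longrightarrow> par (Prod T u) (Prod T' u')"
| beta: "par v v' \<Longrightarrow> par u u' \<Longrightarrow> par (App (Lam U v) u) (inst v' u')"

inductive_cases par_SrtE: "par (Srt s) t"
inductive_cases par_VarE: "par (Var x) t"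
inductive_cases par_SymE: "par (Sym f) t"
inductive_cases par_LamE: "par (Lam T u) t"
inductive_cases par_AppE: "par (App t u) w"
inductive_cases par_ProdE: "par (Prod T u) t"

lemma par_refl [simp, intro]: "par t t"
  by (induction t) (auto intro: par.intros)

lemma par_ren: "par t t' \<Longrightarrow> par (ren \<rho> t) (ren \<rho> t')"
  by (induction arbitrary: \<rho> rule: par.induct) (auto simp: ren_inst intro: par.intros)

lemma par_up: "(\<And>x. par (\<sigma> x) (\<tau> x)) \<Longrightarrow> par (up \<sigma> x) (up \<tau> x)"
  by (cases x) (auto intro: par_ren)

lemma par_subst:
  "par t t' \<Longrightarrow> (\<And>x. par (\<sigma> x) (\<tau> x)) \<Longrightarrow> par (subst \<sigma> t) (subst \<tau> t')"
proof (induction arbitrary: \<sigma> \<tau> rule: par.induct)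
  case (beta v v' u u' U)
  have "par (subst (up \<sigma>) v) (subst (up \<tau>) v')" "par (subst \<sigma> u) (subst \<tau> u')"
    using beta.prems by (auto intro!: beta.IH par_up)
  then show ?case by (simp add: subst_inst par.beta)
next
  case (Lam T T' u u')
  have "par (subst (up \<sigma>) u) (subst (up \<tau>) u')"
    using Lam.prems by (intro Lam.IH par_up)
  with Lam show ?case by (simp add: par.Lam)
next
  case (Prod T T' u u')
  have "par (subst (up \<sigma>) u) (subst (up \<tau>) u')"
    using Prod.prems by (intro Prod.IH par_up)
  with Prod show ?case by (simp add: par.Prod)
qed (auto intro: par.intros)

lemma par_inst: "par v v' \<Longrightarrow> par u u' \<Longrightarrow> par (inst v u) (inst v' u')"
  unfolding inst_def by (rule par_subst) (auto split: nat.split)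

text \<open>The only critical pair is a redex contracted on one side and reduced inside its
  components on the other; \<open>par_inst\<close> closes it, as well as the case of two
  contractions.\<close>

lemma par_diamond:
  "par t u \<Longrightarrow> par t v \<Longrightarrow> \<exists>w. par u w \<and> par v w"
proof (induction arbitrary: v rule: par.induct)
  case (Lam T T' u u')
  from Lam.prems obtain T1 u1 where v: "v = Lam T1 u1" and 1: "par T T1" "par u u1"
    by (rule par_LamE)
  from Lam.IH 1 show ?case unfolding v by (meson par.Lam)
next
  case (Prod T T' u u')
  from Prod.prems obtain T1 u1 where v: "v = Prod T1 u1" and 1: "par T T1" "par u u1"
    by (rule par_ProdE)
  from Prod.IH 1 show ?case unfolding v by (meson par.Prod)
next
  case (App t t' u u')
  from App.prems show ?case
  proof (rule par_AppE)
    fix t1 u1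
    assume v: "v = App t1 u1" and 1: "par t t1" "par u u1"
    from App.IH 1 show ?case unfolding v by (meson par.App)
  next
    fix b b1 u1 U
    assume t: "t = Lam U b" and v: "v = inst b1 u1" and 1: "par b b1" "par u u1"
    from App.hyps(1) t obtain U' b' where t': "t' = Lam U' b'" by (auto elim: par_LamE)
    \<comment> \<open>The induction hypothesis concerns the whole abstraction \<open>t\<close>, not
      its body, so \<open>b1\<close> is wrapped in an abstraction. The common reduct is then again
      an abstraction, with body \<open>b2\<close>.\<close>
    have "par t (Lam U b1)" using 1 t by (auto intro: par.Lam)
    from App.IH(1)[OF this] obtain b2 where b2: "par b' b2" "par b1 b2"
      unfolding t' by (auto elim!: par_LamE)
    from App.IH(2)[OF 1(2)] obtain u2 where u2: "par u' u2" "par u1 u2" by blast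
    show ?case unfolding t' v using b2 u2 by (blast intro: par.beta par_inst)
  qed
next
  case (beta b b' u u' U)
  from beta.prems show ?case
  proof (rule par_AppE)
    fix t1 u1
    assume v: "v = App t1 u1" and 1: "par (Lam U b) t1" "par u u1"
    from 1(1) obtain U1 b1 where t1: "t1 = Lam U1 b1" and b1: "par b b1" by (rule par_LamE)
    from beta.IH(1)[OF b1] beta.IH(2)[OF 1(2)]
    show ?case unfolding v t1 by (blast intro: par.beta par_inst)
  next
    fix b0 b1 u1 U0
    assume "Lam U b = Lam U0 b0" and v: "v = inst b1 u1" and 1: "par b0 b1" "par u u1"
    then have "par b b1" by simp
    from beta.IH(1)[OF this] beta.IH(2)[OF 1(2)]
    show ?case unfolding v by (blast intro: par_inst)
  qed
qed (auto elim: par_SrtE par_VarE par_SymE)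

lemma beta_imp_par:
  assumes "beta t t'"
  shows "par t t'"
  using assms unfolding beta_conv_cclosure
  by (induction rule: cclosure.induct) (auto simp: beta_redex_def intro: par.intros)

lemma par_imp_betas:
  assumes "par t t'"
  shows "beta\<^sup>*\<^sup>* t t'"
  using assms unfolding beta_conv_cclosure
proof (induction rule: par.induct)
  case (beta v v' u u' U)
  have "(cclosure beta_redex)\<^sup>*\<^sup>* (App (Lam U v) u) (App (Lam U v') u')"
    by (intro rtranclp_cclosure_congs beta.IH rtranclp.rtrancl_refl)
  moreover have "cclosure beta_redex (App (Lam U v') u') (inst v' u')"
    by (auto simp: beta_redex_def intro: cclosure.root)
  ultimately show ?case by (rule rtranclp.rtrancl_into_rtrancl)
qed (simp_all add: rtranclp_cclosure_congs)

subsection \<open>Commutation of parallel \<open>\<beta>\<close>-reduction with rewriting\<close>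

lemma occs_pos_iff: "0 < occs x t \<longleftrightarrow> x \<in> FV t"
  by (induction t arbitrary: x) auto

lemma linear_trm_App:
  assumes "linear_trm (App t u)"
  shows "linear_trm t" "linear_trm u" "FV t \<inter> FV u = {}"
proof -
  have occs: "occs x t + occs x u \<le> 1" for x
    using assms by (simp add: linear_trm_def)
  show "linear_trm t" "linear_trm u"
    using occs unfolding linear_trm_def by (meson add_leD1 add_leD2)+
  show "FV t \<inter> FV u = {}"
  proof (intro equals0I)
    fix x assume "x \<in> FV t \<inter> FV u"
    then have "0 < occs x t" "0 < occs x u" by (simp_all add: occs_pos_iff)
    with occs[of x] show False by simp
  qed
qed

lemma apps_snoc: "apps f (ts @ [t]) = App (apps f ts) t"
  by (simp add: apps_def)

lemma subst_apps_neq_Lam: "subst \<sigma> (apps f ts) \<noteq> Lam T u"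
  by (cases ts rule: rev_cases) (simp_all add: apps_def)

text \<open>No application inside \<open>l\<close> becomes a redex, because its function part is
  headed by a symbol. So \<open>par\<close> acts below the variables of \<open>l\<close>, and by
  linearity no variable receives two different reducts.\<close>

lemma par_subst_algebraic:
  assumes "algebraic ar l" "linear_trm l" "par (subst \<sigma> l) u"
  shows "\<exists>\<sigma>'. u = subst \<sigma>' l \<and> (\<forall>x. par (\<sigma> x) (\<sigma>' x))"
  using assms
proof (induction arbitrary: u rule: algebraic.induct)
  case (1 x)
  then show ?case by (intro exI[of _ "\<sigma>(x := u)"]) simp
next
  case (2 ts f)
  \<comment> \<open>A partial application need not be algebraic, so the outer induction does not
    reach it. An inner induction adds the arguments one at a time, and the inclusion in
    \<open>set ts\<close> keeps the outer hypothesis available for each of them.\<close>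
  have "linear_trm (apps f us) \<Longrightarrow> par (subst \<sigma> (apps f us)) u \<Longrightarrow>
      \<exists>\<sigma>'. u = subst \<sigma>' (apps f us) \<and> (\<forall>x. par (\<sigma> x) (\<sigma>' x))"
    if "set us \<subseteq> set ts" for us u
    using that
  proof (induction us arbitrary: u rule: rev_induct)
    case Nil
    then show ?case by (auto simp: apps_def elim: par_SymE)
  next
    case (snoc t us)
    note lin = linear_trm_App[OF snoc.prems(1)[unfolded apps_snoc]]
    from snoc.prems(2) obtain a b where u: "u = App a b"
      and a: "par (subst \<sigma> (apps f us)) a" and b: "par (subst \<sigma> t) b"
      by (auto simp: apps_snoc subst_apps_neq_Lam elim!: par_AppE)
    obtain \<sigma>1 where \<sigma>1: "a = subst \<sigma>1 (apps f us)" "\<And>x. par (\<sigma> x) (\<sigma>1 x)"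
      using snoc.IH[OF lin(1) a] snoc.prems(3) by auto
    obtain \<sigma>2 where \<sigma>2: "b = subst \<sigma>2 t" "\<And>x. par (\<sigma> x) (\<sigma>2 x)"
      using "2.IH"[of t b] lin(2) b snoc.prems(3) by auto
    \<comment> \<open>By linearity the last argument shares no variable with the preceding part, so
      the two reduced substitutions can be glued.\<close>
    define \<sigma>' where "\<sigma>' = (\<lambda>x. if x \<in> FV t then \<sigma>2 x else \<sigma>1 x)"
    have "a = subst \<sigma>' (apps f us)"
      unfolding \<sigma>1(1) by (rule subst_cong_FV) (use lin(3) in \<open>auto simp: \<sigma>'_def\<close>)
    moreover have "b = subst \<sigma>' t"
      unfolding \<sigma>2(1) by (rule subst_cong_FV) (auto simp: \<sigma>'_def)
    moreover have "\<forall>x. par (\<sigma> x) (\<sigma>' x)"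
      using \<sigma>1(2) \<sigma>2(2) by (simp add: \<sigma>'_def)
    ultimately show ?case unfolding u apps_snoc by auto
  qed
  from this[OF subset_refl] 2 show ?case by blast
qed

section \<open>Commutation for one left-linear set of rules, later used for both \<open>E\<close>
  and \<open>R\<close>\<close>

context
  fixes ar :: "'f \<Rightarrow> nat" and S :: "'f trm rel"
  assumes rules: "rewrite_rules ar S" and left_lin: "left_linear S"
begin

text \<open>This excludes an overlap of a rule with the abstraction of a beta redex.\<close>

lemma rule_inst_neq_Lam: "\<not> rule_inst S (Lam T u) w"
proof
  assume "rule_inst S (Lam T u) w"
  then obtain l r \<sigma> where "(l, r) \<in> S" and eq: "Lam T u = subst \<sigma> l"
    by (auto simp: rule_inst_def)
  with rules have "algebraic ar l" "\<forall>x. l \<noteq> Var x" by (auto simp: rewrite_rules_def)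
  then show False using eq subst_apps_neq_Lam by (metis algebraic.cases)
qed

text \<open>The same rule applies with the reduced substitution, and one parallel step reduces all
  the copies that \<open>r\<close> makes of a variable.\<close>

lemma par_rule_inst:
  assumes "par t u" "rule_inst S t v"
  shows "\<exists>w. rule_inst S u w \<and> par v w"
proof -
  from assms(2) obtain l r \<sigma> where lr: "(l, r) \<in> S" and t: "t = subst \<sigma> l" and v: "v = subst \<sigma> r"
    by (auto simp: rule_inst_def)
  have "algebraic ar l" "linear_trm l"
    using lr rules left_lin by (auto simp: rewrite_rules_def left_linear_def)
  from par_subst_algebraic[OF this assms(1)[unfolded t]]
  obtain \<sigma>' where \<sigma>': "u = subst \<sigma>' l" "\<And>x. par (\<sigma> x) (\<sigma>' x)" by blast
  have "rule_inst S u (subst \<sigma>' r)" using lr \<sigma>'(1) by (auto simp: rule_inst_def)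
  moreover have "par v (subst \<sigma>' r)" unfolding v by (rule par_subst) (use \<sigma>' in auto)
  ultimately show ?thesis by blast
qed

text \<open>The contraction of a beta redex may copy or erase the rewritten subterm, so the rewrite
  step becomes any number of steps. The other side remains a single \<open>par\<close> step, and
  this lets the square be repeated along a rewrite sequence.\<close>

lemma par_rstep:
  assumes "par t u" "rstep S t v"
  shows "\<exists>w. (rstep S)\<^sup>*\<^sup>* u w \<and> par v w"
  using assms
proof (induction arbitrary: v rule: par.induct)
  case (Lam T T' u u')
  from Lam.prems[unfolded rstep_conv_cclosure] show ?case
  proof cases
    case root
    then show ?thesis by (simp add: rule_inst_neq_Lam)
  next
    case (LamL T1)
    with Lam.IH(1)[of T1] Lam.hyps show ?thesis unfolding rstep_conv_cclosure
      by (blast intro: rtranclp_cclosure_congs par.Lam)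
  next
    case (LamR u1)
    with Lam.IH(2)[of u1] Lam.hyps show ?thesis unfolding rstep_conv_cclosure
      by (blast intro: rtranclp_cclosure_congs par.Lam)
  qed
next
  case (Prod T T' u u')
  from Prod.prems[unfolded rstep_conv_cclosure] show ?case
  proof cases
    case root
    with par_rule_inst[OF par.Prod[OF Prod.hyps]] show ?thesis unfolding rstep_conv_cclosure
      by (blast intro: cclosure.root)
  next
    case (ProdL T1)
    with Prod.IH(1)[of T1] Prod.hyps show ?thesis unfolding rstep_conv_cclosure
      by (blast intro: rtranclp_cclosure_congs par.Prod)
  next
    case (ProdR u1)
    with Prod.IH(2)[of u1] Prod.hyps show ?thesis unfolding rstep_conv_cclosure
      by (blast intro: rtranclp_cclosure_congs par.Prod)
  qed
next
  case (App T T' u u')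
  from App.prems[unfolded rstep_conv_cclosure] show ?case
  proof cases
    case root
    with par_rule_inst[OF par.App[OF App.hyps]] show ?thesis unfolding rstep_conv_cclosure
      by (blast intro: cclosure.root)
  next
    case (AppL T1)
    with App.IH(1)[of T1] App.hyps show ?thesis unfolding rstep_conv_cclosure
      by (blast intro: rtranclp_cclosure_congs par.App)
  next
    case (AppR u1)
    with App.IH(2)[of u1] App.hyps show ?thesis unfolding rstep_conv_cclosure
      by (blast intro: rtranclp_cclosure_congs par.App)
  qed
next
  case (beta b b' u u' U)
  from beta.prems[unfolded rstep_conv_cclosure] show ?case
  proof cases
    case root
    with par_rule_inst[OF par.beta[OF beta.hyps]] show ?thesis unfolding rstep_conv_cclosure
      by (blast intro: cclosure.root)
  next
    case (AppL t1)
    from AppL(2) show ?thesis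
    proof cases
      case root
      then show ?thesis by (simp add: rule_inst_neq_Lam)
    next
      \<comment> \<open>The rewritten domain is erased by the contraction, so zero rewrite steps
        close the square.\<close>
      case (LamL U1)
      then show ?thesis using AppL(1) beta.hyps by (blast intro: par.beta)
    next
      case (LamR b1)
      from beta.IH(1)[of b1] LamR(2) obtain b2 where "(rstep S)\<^sup>*\<^sup>* b' b2" "par b1 b2"
        by (auto simp: rstep_conv_cclosure)
      then show ?thesis using AppL(1) LamR(1) beta.hyps
        by (blast intro: par.beta rstep_rtranclp_inst)
    qed
  next
    case (AppR u1)
    from beta.IH(2)[of u1] AppR(2) obtain u2 where "(rstep S)\<^sup>*\<^sup>* u' u2" "par u1 u2"
      by (auto simp: rstep_conv_cclosure)
    then show ?thesis using AppR(1) beta.hyps by (blast intro: par.beta rstep_rtranclp_inst)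
  qed
qed blast+

lemma par_rsteps:
  assumes "(rstep S)\<^sup>*\<^sup>* t v" "par t u"
  shows "\<exists>w. (rstep S)\<^sup>*\<^sup>* u w \<and> par v w"
  using assms
proof (induction rule: rtranclp_induct)
  case (step v v')
  then obtain w where "(rstep S)\<^sup>*\<^sup>* u w" "par v w" by blast
  with par_rstep[OF \<open>par v w\<close> step.hyps(2)] show ?case by (meson rtranclp_trans)
qed blast

end

subsection \<open>Confluence\<close>

lemma rule_inst_sym: "sym S \<Longrightarrow> rule_inst S t u \<Longrightarrow> rule_inst S u t"
  unfolding rule_inst_def by (blast dest: symD)

lemma rstep_sym:
  assumes "sym S" "rstep S t u"
  shows "rstep S u t"
  using assms(2) unfolding rstep_conv_cclosure
  by (induction rule: cclosure.induct) (auto intro: cclosure.intros rule_inst_sym[OF assms(1)])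

lemma equiv_mod_sym:
  assumes "sym E" "equiv_mod E t u"
  shows "equiv_mod E u t"
  using assms(2) unfolding equiv_mod_def
  by (induction rule: rtranclp_induct)
    (auto intro: rstep_sym[OF assms(1)] converse_rtranclp_into_rtranclp)

lemma equiv_mod_trans: "equiv_mod E t u \<Longrightarrow> equiv_mod E u v \<Longrightarrow> equiv_mod E t v"
  unfolding equiv_mod_def by (rule rtranclp_trans)

lemma equiv_mod_refl: "equiv_mod E t t"
  by (simp add: equiv_mod_def)

text \<open>Zero rewrite steps are allowed, so \<open>equiv_mod E\<close> is included. Equivalence
  at both ends makes the relation absorb \<open>equiv_mod E\<close> on either side.\<close>

definition rsteps_mod :: "'f trm rel \<Rightarrow> 'f trm rel \<Rightarrow> 'f trm \<Rightarrow> 'f trm \<Rightarrow> bool" where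
  "rsteps_mod E R = equiv_mod E OO (rstep R)\<^sup>*\<^sup>* OO equiv_mod E"

text \<open>By symmetry the leading equivalences join into one between \<open>t1\<close> and
  \<open>t2\<close>, which is the situation of the confluence hypothesis; the trailing ones are
  reversed and absorbed.\<close>

lemma rsteps_mod_diamond:
  assumes "sym E" and conf: "confluent_on_classes (equiv_mod E) (rstep R)"
    and "rsteps_mod E R t u" "rsteps_mod E R t v"
  shows "\<exists>w. rsteps_mod E R u w \<and> rsteps_mod E R v w"
proof -
  from assms(3) obtain t1 u1
    where u: "equiv_mod E t t1" "(rstep R)\<^sup>*\<^sup>* t1 u1" "equiv_mod E u1 u"
    by (auto simp: rsteps_mod_def)
  from assms(4) obtain t2 v1
    where v: "equiv_mod E t t2" "(rstep R)\<^sup>*\<^sup>* t2 v1" "equiv_mod E v1 v"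
    by (auto simp: rsteps_mod_def)
  have "equiv_mod E t1 t2"
    using u(1) v(1) equiv_mod_sym[OF assms(1)] equiv_mod_trans by metis
  with conf u(2) v(2) obtain u2 v2
    where 2: "(rstep R)\<^sup>*\<^sup>* u1 u2" "(rstep R)\<^sup>*\<^sup>* v1 v2" "equiv_mod E u2 v2"
    unfolding confluent_on_classes_def by blast
  have "rsteps_mod E R u v2"
    unfolding rsteps_mod_def using u(3) 2 equiv_mod_sym[OF assms(1)] by blast
  moreover have "rsteps_mod E R v v2"
    unfolding rsteps_mod_def using v(3) 2 equiv_mod_sym[OF assms(1)] equiv_mod_refl by blast
  ultimately show ?thesis by blast
qed

text \<open>The \<open>par\<close> step is carried across the three segments in turn, and stays a
  single step each time.\<close>

lemma par_rsteps_mod: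
  assumes "rewrite_rules ar E" "left_linear E" "rewrite_rules ar R" "left_linear R"
    and "par t u" "rsteps_mod E R t v"
  shows "\<exists>w. rsteps_mod E R u w \<and> par v w"
proof -
  from assms(6) obtain t1 v1
    where v: "equiv_mod E t t1" "(rstep R)\<^sup>*\<^sup>* t1 v1" "equiv_mod E v1 v"
    by (auto simp: rsteps_mod_def)
  note parE = par_rsteps[OF assms(1,2), folded equiv_mod_def]
  from parE[OF v(1) assms(5)] obtain u1 where u1: "equiv_mod E u u1" "par t1 u1" by blast
  from par_rsteps[OF assms(3,4) v(2) u1(2)] obtain u2
    where u2: "(rstep R)\<^sup>*\<^sup>* u1 u2" "par v1 u2" by blast
  from parE[OF v(3) u2(2)] obtain w where "equiv_mod E u2 w" "par v w" by blast
  with u1 u2 show ?thesis unfolding rsteps_mod_def by blast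
qed

section \<open>From the union back to the combined relation\<close>

lemma betas_imp_red_mods: "beta\<^sup>*\<^sup>* t u \<Longrightarrow> (red_mod E R)\<^sup>*\<^sup>* t u"
  by (erule rtranclp_mono[THEN predicate2D, rotated]) (auto simp: red_mod_def)

lemma rsteps_imp_red_mods: "(rstep R)\<^sup>*\<^sup>* t u \<Longrightarrow> (red_mod E R)\<^sup>*\<^sup>* t u"
  by (erule rtranclp_mono[THEN predicate2D, rotated])
    (unfold red_mod_def, blast intro: equiv_mod_refl)

text \<open>The leading equivalence is absorbed into the first rewrite step, which makes it a
  \<open>red_mod\<close> step. Without any rewrite step it merges with the trailing
  equivalence.\<close>

lemma rsteps_mod_imp_red_mods:
  assumes "rsteps_mod E R t u"
  shows "((red_mod E R)\<^sup>*\<^sup>* OO equiv_mod E) t u"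
proof -
  from assms obtain t1 u1
    where 1: "equiv_mod E t t1" "(rstep R)\<^sup>*\<^sup>* t1 u1" "equiv_mod E u1 u"
    by (auto simp: rsteps_mod_def)
  from 1(2) show ?thesis
  proof (cases rule: converse_rtranclpE)
    case base
    with 1 show ?thesis by (blast intro: equiv_mod_trans)
  next
    case (step t2)
    with 1(1) have "red_mod E R t t2" by (auto simp: red_mod_def)
    then have "(red_mod E R)\<^sup>*\<^sup>* t u1"
      using rsteps_imp_red_mods[OF step(2)] by (rule converse_rtranclp_into_rtranclp)
    with 1(3) show ?thesis by blast
  qed
qed

lemma sup_rtranclp_imp_red_mods:
  assumes "sym E" "rewrite_rules ar E" "left_linear E"
    and "(sup par (rsteps_mod E R))\<^sup>*\<^sup>* t u"
  shows "((red_mod E R)\<^sup>*\<^sup>* OO equiv_mod E) t u"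
  using assms(4)
proof (induction rule: rtranclp_induct)
  case base
  then show ?case by (blast intro: equiv_mod_refl)
next
  case (step u v)
  then obtain u1 where u1: "(red_mod E R)\<^sup>*\<^sup>* t u1" "equiv_mod E u1 u" by blast
  from step.hyps(2) have "((red_mod E R)\<^sup>*\<^sup>* OO equiv_mod E) u1 v"
  proof (elim sup2E)
    assume "par u v"
    \<comment> \<open>The equivalence from \<open>u1\<close> to \<open>u\<close> is reversed and
      commuted with \<open>par\<close>, which moves it behind the step: \<open>u1\<close> reduces to
      some \<open>w\<close> equivalent to \<open>v\<close>.\<close>
    with par_rsteps[OF assms(2,3), folded equiv_mod_def, OF equiv_mod_sym[OF assms(1) u1(2)]]
    obtain w where "equiv_mod E v w" "par u1 w" by blast
    then show ?thesis
      using equiv_mod_sym[OF assms(1)] betas_imp_red_mods[OF par_imp_betas] by blast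
  next
    assume "rsteps_mod E R u v"
    with u1(2) have "rsteps_mod E R u1 v"
      unfolding rsteps_mod_def by (blast intro: equiv_mod_trans)
    then show ?thesis by (rule rsteps_mod_imp_red_mods)
  qed
  then obtain v1 where "(red_mod E R)\<^sup>*\<^sup>* u1 v1" "equiv_mod E v1 v" by blast
  with rtranclp_trans[OF u1(1)] show ?case by blast
qed

theorem theorem6:
  fixes ar :: "'f \<Rightarrow> nat" and E R :: "'f trm rel"
  assumes "equations ar E" and "rewrite_rules ar R"
    and "linear_rules E"
    and "left_linear R"
    and "confluent_on_classes (equiv_mod E) (rstep R)"
  shows "confluent_on_classes (equiv_mod E) (red_mod E R)"
proof -
  have E: "sym E" "rewrite_rules ar E" "left_linear E"
    using assms(1,3) by (auto simp: equations_def linear_rules_def left_linear_def)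
  let ?W = "sup par (rsteps_mod E R)"
  have diamond: "\<exists>d. ?W b d \<and> ?W c d" if "?W a b" "?W a c" for a b c
    using that par_diamond[of a b c] rsteps_mod_diamond[OF E(1) assms(5), of a b c]
      par_rsteps_mod[OF E(2,3) assms(2,4), of a b c]
      par_rsteps_mod[OF E(2,3) assms(2,4), of a c b]
    by auto
  \<comment> \<open>The diamond property is the instance of strong confluence with one closing step
    on each side.\<close>
  have confl: "confluentp ?W"
    by (intro strong_confluentp_imp_confluentp strong_confluentpI) (use diamond in blast)
  have equiv_W: "?W t u" if "equiv_mod E t u" for t u
    using that equiv_mod_refl unfolding rsteps_mod_def by blast
  have "?W t u" if "red_mod E R t u" for t u
    using that beta_imp_par equiv_mod_refl unfolding red_mod_def rsteps_mod_def by blast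
  then have red_W: "(red_mod E R)\<^sup>*\<^sup>* \<le> ?W\<^sup>*\<^sup>*"
    by (intro rtranclp_mono) blast
  show ?thesis
    unfolding confluent_on_classes_def
  proof (intro allI impI, elim conjE)
    fix t t' u v
    assume "(red_mod E R)\<^sup>*\<^sup>* t u" "equiv_mod E t t'" "(red_mod E R)\<^sup>*\<^sup>* t' v"
    \<comment> \<open>Equivalence is itself a \<open>?W\<close> step, so the two sources
      \<open>t\<close> and \<open>t'\<close> become a single peak at \<open>t\<close>.\<close>
    then have "?W\<^sup>*\<^sup>* t u" "?W\<^sup>*\<^sup>* t v"
      using red_W equiv_W[of t t'] by (auto intro: converse_rtranclp_into_rtranclp)
    from confluentpD[OF confl this] obtain w
      where w: "?W\<^sup>*\<^sup>* u w" "?W\<^sup>*\<^sup>* v w" by blast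
    \<comment> \<open>Each branch leaves an equivalence with the common \<open>w\<close>, and
      together these relate \<open>u'\<close> and \<open>v'\<close>.\<close>
    obtain u' v' where "(red_mod E R)\<^sup>*\<^sup>* u u'" "equiv_mod E u' w"
      "(red_mod E R)\<^sup>*\<^sup>* v v'" "equiv_mod E v' w"
      using sup_rtranclp_imp_red_mods[OF E w(1)] sup_rtranclp_imp_red_mods[OF E w(2)]
      by (elim relcomppE)
    then show "\<exists>u' v'. (red_mod E R)\<^sup>*\<^sup>* u u' \<and> (red_mod E R)\<^sup>*\<^sup>* v v' \<and> equiv_mod E u' v'"
      using equiv_mod_sym[OF E(1)] equiv_mod_trans by metis
  qed
qed

end
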